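(* Let $0<\beta\le 1$. The fractional linear multistep method $$\sum_{k=0}^{\infty} g_k^{(\beta)}\left[\left(1+\frac{\beta}{2}\right)y_{n-k}-\frac{\beta}{2}\,y_{n-k-1}\right]=h^\beta f_n,\qquad n=1,2,\dots,$$ is $A$-stable; that is, $\Sigma_\beta\subseteq S$, where $\Sigma_\beta=\{z\in\mathbb{C}\setminus\{0\}:|\arg(z)|>\frac{\beta\pi}{2}\}$ and $S$ is the stability region of the method.
   Context: The Grünwald weights $g_k^{(\beta)}$ are defined by $(1-z)^\beta=\sum_{k\ge 0}g_k^{(\beta)}z^k$. In the method, $h>0$ is the step size, $t_n=nh$, $y_n$ approximates $y(t_n)$, and $f_n=f(t_n,y_n)$. The generating function of the method is $\delta(\xi)=(1-\xi)^\beta\left[\left(1+\frac{\beta}{2}\right)-\frac{\beta}{2}\,\xi\right]$ for $|\xi|\le 1$, where $(1-\xi)^\beta$ is the principal branch (with value $0$ at $\xi=1$). The unstable region of the method is $S^c=\{\delta(\xi):\xi\in\mathbb{C},\ |\xi|\le 1\}$, and its stability region is $S=\mathbb{C}\setminus S^c$. The argument $\arg$ takes values in $(-\pi,\pi]$. A method with stability region $S$ for a fractional problem of order $\beta$ is called $A$-stable if $\Sigma_\beta\subseteq S$. *)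

theory Defs
  imports "HOL-Complex_Analysis.Complex_Analysis"
begin

definition grunwald :: "real \<Rightarrow> nat \<Rightarrow> real" where
  "grunwald \<beta> k = (-1) ^ k * (\<beta> gchoose k)"

lemma grunwald_sums:
  fixes z :: complex
  assumes "norm z < 1"
  shows "(\<lambda>k. of_real (grunwald \<beta> k) * z ^ k) sums ((1 - z) powr of_real \<beta>)"
proof -
  have *: "of_real (\<beta> gchoose k) = ((of_real \<beta> :: complex) gchoose k)" for k
    by (simp add: gbinomial_prod_rev)
  have "(\<lambda>k. (of_real \<beta> gchoose k) * (- z) ^ k) sums ((1 + (- z)) powr of_real \<beta>)"
    using gen_binomial_complex[of "- z" "of_real \<beta>"] assms by simp
  also have "(\<lambda>k. (of_real \<beta> gchoose k) * (- z) ^ k) = (\<lambda>k. of_real (grunwald \<beta> k) * z ^ k)"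
  proof
    fix k
    have "(- z) ^ k = (-1) ^ k * z ^ k"
      by (rule power_minus)
    then show "(of_real \<beta> gchoose k) * (- z) ^ k = of_real (grunwald \<beta> k) * z ^ k"
      unfolding grunwald_def of_real_mult * by simp
  qed
  finally show ?thesis by simp
qed

text \<open>
  The sequence \<open>y\<close> is indexed by the integers because the sum over \<open>k\<close> reaches
  back over the whole history, including the values at nonpositive indices.
\<close>
definition fractional_lmm ::
  "real \<Rightarrow> real \<Rightarrow> (real \<Rightarrow> complex \<Rightarrow> complex) \<Rightarrow> (int \<Rightarrow> complex) \<Rightarrow> bool" where
  "fractional_lmm \<beta> h f y \<longleftrightarrow>
     (\<forall>n\<ge>1. (\<lambda>k. of_real (grunwald \<beta> k) *
                 (of_real (1 + \<beta> / 2) * y (n - int k) - of_real (\<beta> / 2) * y (n - int k - 1)))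
              sums (of_real (h powr \<beta>) * f (of_int n * h) (y n)))"

text \<open>
  Here \<open>powr\<close> is the principal branch, and \<open>0 powr \<beta> = 0\<close> gives the value \<open>0\<close> at \<open>\<xi> = 1\<close>.
\<close>
definition generating_function :: "real \<Rightarrow> complex \<Rightarrow> complex" where
  "generating_function \<beta> \<xi> =
     (1 - \<xi>) powr of_real \<beta> * (of_real (1 + \<beta> / 2) - of_real (\<beta> / 2) * \<xi>)"

text \<open>
  This ties the closed form to the method: on the test problem \<open>f t y = \<lambda> y\<close>, the
  geometric sequence with ratio \<open>1 / \<xi>\<close> solves the method iff \<open>h powr \<beta> * \<lambda>\<close> is the value
  of the generating function at \<open>\<xi>\<close>.
\<close>
lemma fractional_lmm_geometric_iff:
  assumes "\<xi> \<noteq> 0" and "norm \<xi> < 1"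
  shows "fractional_lmm \<beta> h (\<lambda>t y. l * y) (\<lambda>n. \<xi> powi (- n)) \<longleftrightarrow>
           of_real (h powr \<beta>) * l = generating_function \<beta> \<xi>"
proof -
  define c where "c = (of_real (1 + \<beta> / 2) - of_real (\<beta> / 2) * \<xi> :: complex)"
  have sums: "(\<lambda>k. of_real (grunwald \<beta> k) *
            (of_real (1 + \<beta> / 2) * \<xi> powi (- (n - int k))
             - of_real (\<beta> / 2) * \<xi> powi (- (n - int k - 1))))
          sums (generating_function \<beta> \<xi> * \<xi> powi (- n))" (is "?s n sums _") for n
  proof -
    have a: "\<xi> powi (- (n - int k)) = \<xi> ^ k * \<xi> powi (- n)" for k
      using power_int_add[of \<xi> "int k" "- n"] assms(1) by simp
    have b: "\<xi> powi (- (n - int k - 1)) = \<xi> * (\<xi> ^ k * \<xi> powi (- n))" for k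
      using power_int_add[of \<xi> 1 "- (n - int k)"] assms(1) a[of k] by (simp add: algebra_simps)
    have "?s n = (\<lambda>k. of_real (grunwald \<beta> k) * \<xi> ^ k * (c * \<xi> powi (- n)))"
      unfolding a b c_def by (simp add: algebra_simps)
    then show ?thesis
      using sums_mult2[OF grunwald_sums[OF assms(2)], of \<beta> "c * \<xi> powi (- n)"]
      by (simp add: generating_function_def c_def mult.assoc)
  qed
  have eq: "?s n sums b \<longleftrightarrow> generating_function \<beta> \<xi> * \<xi> powi (- n) = b" for n b
    using sums[of n] sums_unique2[OF sums[of n], of b] by (rule_tac iffI) simp_all
  have "fractional_lmm \<beta> h (\<lambda>t y. l * y) (\<lambda>n. \<xi> powi (- n)) \<longleftrightarrow>
      (\<forall>n::int\<ge>1. generating_function \<beta> \<xi> * \<xi> powi (- n)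
                   = of_real (h powr \<beta>) * (l * \<xi> powi (- n)))"
    unfolding fractional_lmm_def eq by (rule refl)
  also have "\<dots> \<longleftrightarrow> (\<forall>n::int\<ge>1. of_real (h powr \<beta>) * l = generating_function \<beta> \<xi>)"
    using assms(1) by (auto simp flip: mult.assoc)
  also have "\<dots> \<longleftrightarrow> of_real (h powr \<beta>) * l = generating_function \<beta> \<xi>"
    by (meson order_refl)
  finally show ?thesis .
qed

definition unstable_region :: "(complex \<Rightarrow> complex) \<Rightarrow> complex set" where
  "unstable_region \<delta> = {\<delta> \<xi> | \<xi>. norm \<xi> \<le> 1}"

definition stability_region :: "(complex \<Rightarrow> complex) \<Rightarrow> complex set" where
  "stability_region \<delta> = - unstable_region \<delta>"

definition sector :: "real \<Rightarrow> complex set" where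
  "sector \<beta> = {z. z \<noteq> 0 \<and> \<bar>Arg z\<bar> > \<beta> * pi / 2}"

definition A_stable :: "real \<Rightarrow> complex set \<Rightarrow> bool" where
  "A_stable \<beta> S \<longleftrightarrow> sector \<beta> \<subseteq> S"

end

theory Submission
  imports Defs
begin

text \<open>
  Put \<open>w = 1 - \<xi>\<close>, so that \<open>\<bar>w\<bar>\<^sup>2 \<le> 2 Re w\<close> on the unit disc and the generating function is
  \<open>w powr \<beta> * v\<close> with \<open>v = 1 + (\<beta> / 2) w\<close>. Since \<open>Re v \<ge> 1\<close>, we get
  \<open>\<bar>Arg v\<bar> \<le> \<bar>Im v\<bar> \<le> \<beta> \<bar>w\<bar> / 2 \<le> \<beta> cos (Arg w) \<le> \<beta> (\<pi> / 2 - \<bar>Arg w\<bar>)\<close>, which is exactly the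
  room left by \<open>\<beta> \<bar>Arg w\<bar>\<close>, the contribution of the fractional power.
\<close>

text \<open>In the right half-plane \<open>Arg v\<close> is the arctangent of the slope. That is at
  most the slope in modulus, and dividing by \<open>Re v \<ge> 1\<close> only shrinks
  \<open>Im v\<close>.\<close>

lemma abs_Arg_le_abs_Im:
  assumes "1 \<le> Re v"
  shows "\<bar>Arg v\<bar> \<le> \<bar>Im v\<bar>"
proof -
  have "Arg v = arctan (Im v / Re v)"
    using assms by (intro arg_conv_arctan) simp
  then have "\<bar>Arg v\<bar> \<le> \<bar>Im v / Re v\<bar>"
    by (simp only: abs_arctan arctan_le_self abs_ge_zero)
  also have "\<dots> \<le> \<bar>Im v\<bar>"
    using assms by (simp add: divide_le_eq mult_le_cancel_left1)
  finally show ?thesis .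
qed

lemma cos_le_pi_half_minus_abs:
  fixes t :: real
  assumes "\<bar>t\<bar> \<le> pi / 2"
  shows "cos t \<le> pi / 2 - \<bar>t\<bar>"
proof -
  have "cos t = sin (pi / 2 - \<bar>t\<bar>)"
    by (simp add: sin_diff)
  also have "\<dots> \<le> pi / 2 - \<bar>t\<bar>"
    using assms by (intro sin_x_le_x) simp
  finally show ?thesis .
qed

text \<open>Square the hypothesis and expand: the constant 1 cancels.\<close>

lemma norm_square_le_if_norm_one_minus_le:
  fixes w :: complex
  assumes "norm (1 - w) \<le> 1"
  shows "(norm w)\<^sup>2 \<le> 2 * Re w"
proof -
  have "(norm (1 - w))\<^sup>2 \<le> 1"
    using assms by (simp add: power_le_one)
  then show ?thesis
    unfolding cmod_power2 by (simp add: power2_eq_square algebra_simps)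
qed

lemma abs_Arg_powr_mult_le:
  fixes w :: complex and \<beta> :: real
  assumes "0 < \<beta>" "\<beta> \<le> 1" "w \<noteq> 0" "norm (1 - w) \<le> 1"
  shows "\<bar>Arg (w powr of_real \<beta> * (1 + of_real (\<beta> / 2) * w))\<bar> \<le> \<beta> * pi / 2"
proof -
  define v where "v = 1 + of_real (\<beta> / 2) * w"
  have sq: "(norm w)\<^sup>2 \<le> 2 * Re w"
    using assms(4) by (rule norm_square_le_if_norm_one_minus_le)
  have "0 < (norm w)\<^sup>2"
    using assms(3) by simp
  with sq have Re_w: "0 < Re w"
    by linarith
  have v: "1 \<le> Re v"
    using Re_w assms(1) by (simp add: v_def)
  then have "v \<noteq> 0"
    by auto
  have Arg_w: "\<bar>Arg w\<bar> < pi / 2"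
    using Re_Ln_pos_lt_imp[OF Re_w] Arg_eq_Im_Ln[OF assms(3)] by simp
  \<comment> \<open>The disc in polar form: since \<open>Re w = norm w * cos (Arg w)\<close>, one
    factor \<open>norm w\<close> of \<open>sq\<close> cancels.\<close>
  have "norm w * norm w \<le> norm w * (2 * cos (Arg w))"
    using sq cos_Arg[OF assms(3)] assms(3) by (simp add: power2_eq_square)
  then have norm_w: "norm w \<le> 2 * cos (Arg w)"
    using assms(3) by simp
  have "\<bar>Im w\<bar> \<le> norm w"
    by (rule abs_Im_le_cmod)
  also note norm_w
  also have "2 * cos (Arg w) \<le> 2 * (pi / 2 - \<bar>Arg w\<bar>)"
    using Arg_w by (intro mult_left_mono cos_le_pi_half_minus_abs) simp_all
  finally have "\<bar>Im w\<bar> \<le> 2 * (pi / 2 - \<bar>Arg w\<bar>)" .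
  then have Im_w: "\<bar>Im w\<bar> / 2 \<le> pi / 2 - \<bar>Arg w\<bar>"
    by simp
  have "\<bar>Arg v\<bar> \<le> \<bar>Im v\<bar>"
    using v by (rule abs_Arg_le_abs_Im)
  also have "\<dots> = \<beta> * (\<bar>Im w\<bar> / 2)"
    using assms(1) by (simp add: v_def abs_mult)
  also have "\<dots> \<le> \<beta> * (pi / 2 - \<bar>Arg w\<bar>)"
    using Im_w assms(1) by (intro mult_left_mono) simp_all
  finally have "\<bar>Arg v\<bar> \<le> \<beta> * (pi / 2 - \<bar>Arg w\<bar>)" .
  moreover have "\<bar>\<beta> * Arg w\<bar> = \<beta> * \<bar>Arg w\<bar>"
    using assms(1) by (simp add: abs_mult)
  ultimately have le: "\<bar>\<beta> * Arg w + Arg v\<bar> \<le> \<beta> * pi / 2"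
    using abs_triangle_ineq[of "\<beta> * Arg w" "Arg v"] by (simp add: algebra_simps)
  \<comment> \<open>As a single exponential, the product has the sum of the two arguments as the
    imaginary part of its exponent.\<close>
  have "w powr of_real \<beta> * v = exp (of_real \<beta> * Ln w + Ln v)"
    using assms(3) \<open>v \<noteq> 0\<close> by (simp add: powr_def exp_add)
  moreover have "Im (of_real \<beta> * Ln w + Ln v) = \<beta> * Arg w + Arg v"
    using assms(3) \<open>v \<noteq> 0\<close> by (simp add: Arg_eq_Im_Ln)
  \<comment> \<open>Being below \<open>pi\<close> in modulus, the sum is already the principal
    argument, with no multiple of \<open>2 * pi\<close> to subtract.\<close>
  moreover have "\<bar>\<beta> * Arg w + Arg v\<bar> < pi"
  proof -
    have "\<beta> * pi / 2 < pi"
      using assms(2) by simp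
    with le show ?thesis
      by (rule le_less_trans)
  qed
  ultimately have "Arg (w powr of_real \<beta> * v) = \<beta> * Arg w + Arg v"
    using Arg_exp[of "of_real \<beta> * Ln w + Ln v"] by (simp only: abs_less_iff) linarith
  with le show ?thesis
    by (simp add: v_def)
qed

theorem theorem6:
  fixes \<beta> :: real
  assumes "0 < \<beta>" and "\<beta> \<le> 1"
  shows "A_stable \<beta> (stability_region (generating_function \<beta>))"
proof -
  have "generating_function \<beta> \<xi> \<notin> sector \<beta>" if "norm \<xi> \<le> 1" for \<xi>
  proof (cases "\<xi> = 1")
    \<comment> \<open>Here the generating function vanishes, and the sector excludes 0.\<close>
    case True
    then show ?thesis
      by (simp add: generating_function_def sector_def)
  next
    case False
    \<comment> \<open>The linear factor is re-expanded around \<open>\<xi> = 1\<close>.\<close>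
    have "generating_function \<beta> \<xi> = (1 - \<xi>) powr of_real \<beta> * (1 + of_real (\<beta> / 2) * (1 - \<xi>))"
      by (simp add: generating_function_def field_simps)
    then have "\<bar>Arg (generating_function \<beta> \<xi>)\<bar> \<le> \<beta> * pi / 2"
      using abs_Arg_powr_mult_le[OF assms, of "1 - \<xi>"] False that by simp
    then show ?thesis
      by (simp add: sector_def)
  qed
  then show ?thesis
    by (auto simp: A_stable_def stability_region_def unstable_region_def)
qed

end
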